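(* For every reflexive (closed linear) subspace $B$ of $L_1=L_1[0,1]$ there exists a symmetric space $\mathfrak{m}(B)$ with the following properties: 1. $B$ can be transferred into $\mathfrak{m}(B)$; 2. for all $x\in B$, $\|x\|_{L_1}=\|x\|_{\mathfrak{m}(B)}$; 3. if $E\in T(B)$, then $\mathfrak{m}(B)\subset^{c}E$, i.e. $\mathfrak{m}(B)\subseteq E$ as sets of functions and there is a finite constant $c$ (depending on $B$ and $E$) with $\|x\|_E\le c\,\|x\|_{\mathfrak{m}(B)}$ for all $x\in\mathfrak{m}(B)$.
   Context: A symmetric space is a Banach space $E$ of (classes of a.e. equal) Lebesgue measurable real-valued functions on $[0,1]$ such that: (1) if $x\in E$ and $|y(t)|\le|x(t)|$ a.e. then $y\in E$ and $\|y\|_E\le\|x\|_E$; (2) if $x\in E$ and $|y|$ and $|x|$ are equimeasurable, then $y\in E$ and $\|y\|_E=\|x\|_E$. Throughout, every symmetric space is normalized by $\|\chi_{[0,1]}\|_E=1$; under this normalization $L_\infty\subseteq E\subseteq L_1$ with both inclusions of norm at most $1$. Let $B$ be a reflexive subspace of $L_1$ and $E$ a symmetric space. $B$ can be transferred into $E$ if every function $x\in B$ belongs to $E$ and there is a constant $c\in[1,\infty)$ such that $c^{-1}\|x\|_{L_1}\le\|x\|_E\le c\|x\|_{L_1}$ for all $x\in B$. $T(B)$ denotes the class of all symmetric spaces $E$ such that $B$ can be transferred into $E$. *)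

theory Defs
  imports "HOL-Analysis.Analysis"
begin

text \<open>
  Normed spaces are represented as sets of real-valued functions together with a seminorm on
  that set; two functions at seminorm distance 0 represent the same vector. For spaces of classes
  of a.e. equal functions this means that all representatives of a class are members. Values of
  the seminorm off the member set are irrelevant.
\<close>

record 'a fun_space =
  members :: "('a \<Rightarrow> real) set"
  fnorm :: "('a \<Rightarrow> real) \<Rightarrow> real"

definition linear_space :: "('a \<Rightarrow> real) set \<Rightarrow> bool" where
  "linear_space V \<longleftrightarrow>
     (\<lambda>t. 0) \<in> V \<and>
     (\<forall>x\<in>V. \<forall>y\<in>V. (\<lambda>t. x t + y t) \<in> V) \<and>
     (\<forall>a. \<forall>x\<in>V. (\<lambda>t. a * x t) \<in> V)"

definition seminormed_space :: "'a fun_space \<Rightarrow> bool" where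
  "seminormed_space X \<longleftrightarrow>
     linear_space (members X) \<and>
     (\<forall>x\<in>members X. 0 \<le> fnorm X x) \<and>
     (\<forall>x\<in>members X. \<forall>y\<in>members X. fnorm X (\<lambda>t. x t + y t) \<le> fnorm X x + fnorm X y) \<and>
     (\<forall>a. \<forall>x\<in>members X. fnorm X (\<lambda>t. a * x t) = \<bar>a\<bar> * fnorm X x)"

definition norm_limit :: "'a fun_space \<Rightarrow> (nat \<Rightarrow> 'a \<Rightarrow> real) \<Rightarrow> ('a \<Rightarrow> real) \<Rightarrow> bool" where
  "norm_limit X u x \<longleftrightarrow> (\<lambda>n. fnorm X (\<lambda>t. u n t - x t)) \<longlonglongrightarrow> 0"

definition norm_complete :: "'a fun_space \<Rightarrow> bool" where
  "norm_complete X \<longleftrightarrow>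
     (\<forall>u. (\<forall>n. u n \<in> members X) \<and>
          (\<forall>e>0. \<exists>K. \<forall>m\<ge>K. \<forall>n\<ge>K. fnorm X (\<lambda>t. u m t - u n t) < e)
          \<longrightarrow> (\<exists>x\<in>members X. norm_limit X u x))"

text \<open>
  Closedness under limits in the seminorm also forces \<open>B\<close> to contain, with each function,
  every member of \<open>X\<close> at distance 0 from it.
\<close>

definition closed_subspace :: "('a \<Rightarrow> real) set \<Rightarrow> 'a fun_space \<Rightarrow> bool" where
  "closed_subspace B X \<longleftrightarrow>
     B \<subseteq> members X \<and> linear_space B \<and>
     (\<forall>u. \<forall>x\<in>members X. (\<forall>n. u n \<in> B) \<and> norm_limit X u x \<longrightarrow> x \<in> B)"

text \<open>
  The dual space with the operator norm. A functional is any total function that is linear and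
  bounded on the member set; functionals that agree there are at distance 0. A
  member of the dual of the dual, being bounded, does not distinguish such functionals, so
  \<open>reflexive_space\<close> says exactly that the canonical map into the bidual is onto.
\<close>

definition dual_space :: "'a fun_space \<Rightarrow> ('a \<Rightarrow> real) fun_space" where
  "dual_space X =
     \<lparr> members = {\<phi>.
         (\<forall>x\<in>members X. \<forall>y\<in>members X. \<phi> (\<lambda>t. x t + y t) = \<phi> x + \<phi> y) \<and>
         (\<forall>a. \<forall>x\<in>members X. \<phi> (\<lambda>t. a * x t) = a * \<phi> x) \<and>
         (\<exists>C. \<forall>x\<in>members X. \<bar>\<phi> x\<bar> \<le> C * fnorm X x)},
       fnorm = (\<lambda>\<phi>. Sup {\<bar>\<phi> x\<bar> | x. x \<in> members X \<and> fnorm X x \<le> 1}) \<rparr>"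

definition reflexive_space :: "'a fun_space \<Rightarrow> bool" where
  "reflexive_space X \<longleftrightarrow>
     (\<forall>F\<in>members (dual_space (dual_space X)).
        \<exists>x\<in>members X. \<forall>\<phi>\<in>members (dual_space X). F \<phi> = \<phi> x)"

text \<open>
  Functions on \<open>[0,1]\<close> are total functions on the reals whose values off \<open>[0,1]\<close> do not matter.
\<close>

abbreviation unit_leb :: "real measure" where
  "unit_leb \<equiv> lebesgue_on {0..1}"

definition L1 :: "real fun_space" where
  "L1 = \<lparr> members = {x. integrable unit_leb x},
          fnorm = (\<lambda>x. integral\<^sup>L unit_leb (\<lambda>t. \<bar>x t\<bar>)) \<rparr>"

definition equimeasurable :: "(real \<Rightarrow> real) \<Rightarrow> (real \<Rightarrow> real) \<Rightarrow> bool" where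
  "equimeasurable x y \<longleftrightarrow>
     (\<forall>\<tau>. measure unit_leb {t \<in> space unit_leb. x t > \<tau>} =
          measure unit_leb {t \<in> space unit_leb. y t > \<tau>})"

text \<open>The last conjunct is the normalization of the norm.\<close>

definition symmetric_space :: "real fun_space \<Rightarrow> bool" where
  "symmetric_space E \<longleftrightarrow>
     members E \<subseteq> borel_measurable unit_leb \<and>
     seminormed_space E \<and>
     (\<forall>x\<in>members E. fnorm E x = 0 \<longrightarrow> (AE t in unit_leb. x t = 0)) \<and>
     norm_complete E \<and>
     (\<forall>x\<in>members E. \<forall>y\<in>borel_measurable unit_leb.
        (AE t in unit_leb. \<bar>y t\<bar> \<le> \<bar>x t\<bar>) \<longrightarrow> y \<in> members E \<and> fnorm E y \<le> fnorm E x) \<and>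
     (\<forall>x\<in>members E. \<forall>y\<in>borel_measurable unit_leb.
        equimeasurable (\<lambda>t. \<bar>y t\<bar>) (\<lambda>t. \<bar>x t\<bar>) \<longrightarrow> y \<in> members E \<and> fnorm E y = fnorm E x) \<and>
     indicator {0..1} \<in> members E \<and> fnorm E (indicator {0..1}) = 1"

definition transferable :: "(real \<Rightarrow> real) set \<Rightarrow> real fun_space \<Rightarrow> bool" where
  "transferable B E \<longleftrightarrow>
     B \<subseteq> members E \<and>
     (\<exists>c\<ge>1. \<forall>x\<in>B. inverse c * fnorm L1 x \<le> fnorm E x \<and> fnorm E x \<le> c * fnorm L1 x)"

definition transfer_class :: "(real \<Rightarrow> real) set \<Rightarrow> real fun_space set" where
  "transfer_class B = {E. symmetric_space E \<and> transferable B E}"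

definition boundedly_included :: "'a fun_space \<Rightarrow> 'a fun_space \<Rightarrow> bool" where
  "boundedly_included F E \<longleftrightarrow>
     members F \<subseteq> members E \<and> (\<exists>c. \<forall>x\<in>members F. fnorm E x \<le> c * fnorm F x)"

end

theory Submission imports Defs begin

text \<open>
  \<open>\<mm>(B)\<close> is the part of the intersection of all \<open>E \<in> T(B)\<close> on which the following norm is
  finite: the supremum of \<open>\<parallel>\<cdot>\<parallel>\<^sub>E / c\<close> over all pairs \<open>(E, c)\<close> with \<open>c \<ge> 1\<close> and \<open>\<parallel>x\<parallel>\<^sub>E \<le> c \<parallel>x\<parallel>\<^sub>1\<close> on \<open>B\<close>. The pair \<open>(L\<^sub>1, 1)\<close> is among them, which
  gives equality of the norms on \<open>B\<close> and, together with \<open>c \<ge> 1\<close>, the normalization. The one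
  point needing an argument is completeness: a Cauchy sequence has a limit in each \<open>E\<close>, and these
  limits agree because norm convergence in a Banach function lattice implies convergence a.e.
  along a subsequence.
\<close>

section \<open>The interval as a finite measure space; subsequences of norm limits\<close>

lemma emeasure_unit_leb: "emeasure unit_leb {0..1} = 1"
  by (simp add: emeasure_restrict_space)

lemma finite_measure_unit_leb: "finite_measure unit_leb"
  by (rule finite_measureI) (simp add: emeasure_unit_leb)

lemma norm_limit_subseq:
  assumes "norm_limit X u x" "strict_mono (r :: nat \<Rightarrow> nat)"
  shows "norm_limit X (\<lambda>n. u (r n)) x"
  using LIMSEQ_subseq_LIMSEQ[OF assms(1)[unfolded norm_limit_def] assms(2)]
  by (simp add: norm_limit_def o_def)

subsection \<open>Convergence in symmetric spaces\<close>

context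
  fixes E :: "real fun_space"
  assumes E: "symmetric_space E"
begin

section \<open>The axioms in usable form, and finite sums\<close>

lemma symmetric_space_measurable: "x \<in> members E \<Longrightarrow> x \<in> borel_measurable unit_leb"
  using E unfolding symmetric_space_def by blast

lemma symmetric_space_zero: "(\<lambda>t. 0) \<in> members E"
  using E unfolding symmetric_space_def seminormed_space_def linear_space_def by blast

lemma symmetric_space_add:
  assumes "x \<in> members E" "y \<in> members E"
  shows "(\<lambda>t. x t + y t) \<in> members E"
    and "fnorm E (\<lambda>t. x t + y t) \<le> fnorm E x + fnorm E y"
  using E assms unfolding symmetric_space_def seminormed_space_def linear_space_def by blast+

lemma symmetric_space_scale:
  assumes "x \<in> members E"
  shows "(\<lambda>t. a * x t) \<in> members E" and "fnorm E (\<lambda>t. a * x t) = \<bar>a\<bar> * fnorm E x"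
  using E assms unfolding symmetric_space_def seminormed_space_def linear_space_def by blast+

lemma symmetric_space_norm_nonneg: "x \<in> members E \<Longrightarrow> 0 \<le> fnorm E x"
  using E unfolding symmetric_space_def seminormed_space_def by blast

lemma symmetric_space_norm_eq_0: "x \<in> members E \<Longrightarrow> fnorm E x = 0 \<Longrightarrow> AE t in unit_leb. x t = 0"
  using E unfolding symmetric_space_def by blast

lemma symmetric_space_complete:
  assumes "\<And>n. u n \<in> members E"
    and "\<And>e. e > 0 \<Longrightarrow> \<exists>K. \<forall>m\<ge>K. \<forall>n\<ge>K. fnorm E (\<lambda>t. u m t - u n t) < e"
  obtains x where "x \<in> members E" "norm_limit E u x"
proof -
  have "norm_complete E"
    using E unfolding symmetric_space_def by blast
  then have "\<exists>x\<in>members E. norm_limit E u x"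
    unfolding norm_complete_def using assms by blast
  with that show thesis by blast
qed

lemma symmetric_space_solid:
  assumes "x \<in> members E" "y \<in> borel_measurable unit_leb" "AE t in unit_leb. \<bar>y t\<bar> \<le> \<bar>x t\<bar>"
  shows "y \<in> members E" and "fnorm E y \<le> fnorm E x"
  using E assms unfolding symmetric_space_def by blast+

lemma symmetric_space_rearrange:
  assumes "x \<in> members E" "y \<in> borel_measurable unit_leb"
    "equimeasurable (\<lambda>t. \<bar>y t\<bar>) (\<lambda>t. \<bar>x t\<bar>)"
  shows "y \<in> members E" and "fnorm E y = fnorm E x"
  using E assms unfolding symmetric_space_def by blast+

lemma symmetric_space_indicator:
  "indicator {0..1} \<in> members E" "fnorm E (indicator {0..1}) = 1"
  using E unfolding symmetric_space_def by blast+

lemma symmetric_space_diff: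
  assumes "x \<in> members E" "y \<in> members E"
  shows "(\<lambda>t. x t - y t) \<in> members E"
  using symmetric_space_add(1)[OF assms(1) symmetric_space_scale(1)[OF assms(2), of "-1"]] by simp

lemma symmetric_space_norm_zero: "fnorm E (\<lambda>t. 0) = 0"
  using symmetric_space_scale(2)[OF symmetric_space_zero, of 0] by simp

lemma symmetric_space_sum:
  assumes "\<And>k. v k \<in> members E" "finite A"
  shows "(\<lambda>t. \<Sum>k\<in>A. v k t) \<in> members E \<and>
    fnorm E (\<lambda>t. \<Sum>k\<in>A. v k t) \<le> (\<Sum>k\<in>A. fnorm E (v k))"
  using assms(2)
proof (induction A)
  case empty
  show ?case by (simp add: symmetric_space_zero symmetric_space_norm_zero)
next
  case (insert k A)
  with symmetric_space_add[OF assms(1)[of k], of "\<lambda>t. \<Sum>k\<in>A. v k t"] show ?case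
    by simp
qed

text \<open>The positive cone of a Banach lattice is closed.\<close>

lemma norm_limit_AE_upper_bound:
  assumes u: "\<And>n. u n \<in> members E" and x: "x \<in> members E" and lim: "norm_limit E u x"
    and mono: "\<And>m n t. m \<le> n \<Longrightarrow> u m t \<le> u n t"
  shows "AE t in unit_leb. u m t \<le> x t"
proof -
  \<comment> \<open>The positive part of \<open>u m - x\<close> does not depend on \<open>n\<close>,
    yet monotonicity puts it below \<open>\<bar>u n t - x t\<bar>\<close> for every \<open>n\<close>
    from \<open>m\<close> on. Solidity then squeezes its norm to 0.\<close>
  let ?d = "\<lambda>t. max 0 (u m t - x t)"
  have meas: "?d \<in> borel_measurable unit_leb"
    using symmetric_space_measurable[OF u[of m]] symmetric_space_measurable[OF x] by measurable
  have d: "?d \<in> members E \<and> fnorm E ?d \<le> fnorm E (\<lambda>t. u n t - x t)" if "m \<le> n" for n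
  proof -
    have "\<bar>?d t\<bar> \<le> \<bar>u n t - x t\<bar>" for t
      using mono[OF that, of t] by linarith
    then have "AE t in unit_leb. \<bar>?d t\<bar> \<le> \<bar>u n t - x t\<bar>"
      by blast
    then show ?thesis
      using symmetric_space_solid[OF symmetric_space_diff[OF u x] meas] by blast
  qed
  have "fnorm E ?d \<le> 0"
    using lim d unfolding norm_limit_def
    by (intro LIMSEQ_le_const[where X = "\<lambda>n. fnorm E (\<lambda>t. u n t - x t)"]) auto
  with d[of m] have "fnorm E ?d = 0"
    using symmetric_space_norm_nonneg by (auto intro: antisym)
  with d[of m] have "AE t in unit_leb. ?d t = 0"
    using symmetric_space_norm_eq_0 by blast
  then show ?thesis
    by eventually_elim linarith
qed

text \<open>The half of the Riesz-Fischer argument that uses completeness: the partial sums are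
  Cauchy, so they have a norm limit in \<open>E\<close>. Being increasing, they stay a.e. below this
  limit, which is a real-valued function, and bounded nonnegative series converge.\<close>

lemma AE_summable_of_norm_geometric:
  assumes v: "\<And>k. v k \<in> members E" and pos: "\<And>k t. 0 \<le> v k t"
    and bound: "\<And>k. fnorm E (v k) \<le> (1/2)^k"
  shows "AE t in unit_leb. summable (\<lambda>k. v k t)"
proof -
  define S where "S n t = (\<Sum>k<n. v k t)" for n :: nat and t
  have S: "S n \<in> members E" for n
    using symmetric_space_sum[of v "{..<n}"] v unfolding S_def[abs_def] by simp
  have le: "fnorm E (\<lambda>t. S m t - S n t) \<le> 2 * (1/2)^K" if "K \<le> m" "K \<le> n" for K m n
  proof -
    \<comment> \<open>The right-hand side is the exact value of the geometric sum; keeping the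
      subtracted term makes the induction on \<open>j\<close> go through.\<close>
    have *: "(\<Sum>k\<in>{K..<K+j}. fnorm E (v k)) \<le> 2 * (1/2)^K - 2 * (1/2)^(K+j)" for j
    proof (induction j)
      case (Suc j)
      with bound[of "K+j"] show ?case by simp
    qed simp
    have **: "(\<Sum>k\<in>{K..<j}. fnorm E (v k)) \<le> 2 * (1/2)^K" for j
    proof (cases "K \<le> j")
      case True
      then obtain i where "j = K + i" using le_Suc_ex by blast
      with *[of i] show ?thesis by (smt (verit) zero_le_power divide_nonneg_nonneg)
    qed simp
    \<comment> \<open>Summing up to \<open>max m n\<close> makes one function lie above both tails.
      Both tails are nonnegative, so their difference is at most \<open>T\<close> in absolute value,
      whichever of \<open>m\<close> and \<open>n\<close> is larger.\<close>
    define T where "T = (\<lambda>t. \<Sum>k\<in>{K..<max m n}. v k t)"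
    have "S m \<in> members E" "S n \<in> members E" using S by auto
    then have meas: "(\<lambda>t. S m t - S n t) \<in> borel_measurable unit_leb"
      by (intro symmetric_space_measurable symmetric_space_diff)
    have "\<bar>S m t - S n t\<bar> \<le> \<bar>T t\<bar>" for t
    proof -
      have split: "S j t = S K t + (\<Sum>k\<in>{K..<j}. v k t)" if "K \<le> j" for j
        using sum.atLeastLessThan_concat[of 0 K j "\<lambda>k. v k t"] that
        by (simp add: S_def atLeast0LessThan)
      have "(\<Sum>k\<in>{K..<j}. v k t) \<le> T t" if "j \<le> max m n" for j
        unfolding T_def using that pos by (intro sum_mono2) auto
      then have "(\<Sum>k\<in>{K..<m}. v k t) \<le> T t" "(\<Sum>k\<in>{K..<n}. v k t) \<le> T t"
        by auto
      moreover have "0 \<le> (\<Sum>k\<in>{K..<m}. v k t)" "0 \<le> (\<Sum>k\<in>{K..<n}. v k t)"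
        using pos by (auto intro: sum_nonneg)
      ultimately show ?thesis
        using split[OF that(1)] split[OF that(2)] by linarith
    qed
    moreover have T: "T \<in> members E" "fnorm E T \<le> 2 * (1/2)^K"
      using symmetric_space_sum[of v "{K..<max m n}"] v **[of "max m n"]
      unfolding T_def by auto
    ultimately show ?thesis
      using symmetric_space_solid(2)[OF T(1) meas] by (auto intro: order_trans)
  qed
  have "\<exists>K. \<forall>m\<ge>K. \<forall>n\<ge>K. fnorm E (\<lambda>t. S m t - S n t) < e" if "e > 0" for e :: real
  proof -
    obtain K where "(1/2::real)^K < e/2"
      using real_arch_pow_inv[of "e/2" "1/2"] \<open>e > 0\<close> by auto
    then have "2 * (1/2)^K < e"
      by simp
    with le show ?thesis
      by (meson le_less_trans)
  qed
  then obtain x where x: "x \<in> members E" "norm_limit E S x"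
    using symmetric_space_complete[of S, OF S] by blast
  have "AE t in unit_leb. \<forall>n. S n t \<le> x t"
    unfolding AE_all_countable
  proof
    show "AE t in unit_leb. S n t \<le> x t" for n
      by (rule norm_limit_AE_upper_bound[OF S x]) (auto simp: S_def intro: sum_mono2 pos)
  qed
  then show ?thesis
  proof eventually_elim
    case (elim t)
    show ?case
      by (rule summableI_nonneg_bounded[where x = "x t"]) (use elim pos in \<open>auto simp: S_def\<close>)
  qed
qed

text \<open>Choose a subsequence whose k-th norm distance to \<open>x\<close> is at most
  \<open>(1/2)^k\<close>. By the preceding lemma the pointwise distances are a.e. summable, hence
  tend to 0. This is what lets limits in different spaces be compared.\<close>

lemma norm_limit_AE_subseq:
  assumes u: "\<And>n. u n \<in> members E" and x: "x \<in> members E" and lim: "norm_limit E u x"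
  obtains r :: "nat \<Rightarrow> nat"
  where "strict_mono r" "AE t in unit_leb. (\<lambda>k. u (r k) t) \<longlonglongrightarrow> x t"
proof -
  have ev: "\<exists>N. \<forall>n\<ge>N. fnorm E (\<lambda>t. u n t - x t) \<le> (1/2)^k" for k :: nat
    using order_tendstoD(2)[OF lim[unfolded norm_limit_def], of "(1/2)^k"]
    by (auto simp: eventually_sequentially intro: less_imp_le)
  have "\<exists>r. \<forall>k. fnorm E (\<lambda>t. u (r k) t - x t) \<le> (1/2)^k \<and> r k < r (Suc k)"
  proof (intro dependent_nat_choice)
    show "\<exists>n. fnorm E (\<lambda>t. u n t - x t) \<le> (1/2)^0"
      using ev[of 0] by blast
    show "\<exists>n. fnorm E (\<lambda>t. u n t - x t) \<le> (1/2)^Suc k \<and> m < n" for m k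
    proof -
      obtain N where "\<forall>n\<ge>N. fnorm E (\<lambda>t. u n t - x t) \<le> (1/2)^Suc k"
        using ev by blast
      \<comment> \<open>Past \<open>N\<close> the distance is small enough; \<open>Suc m\<close>
        keeps the indices strictly increasing.\<close>
      then show ?thesis
        by (intro exI[of _ "max N (Suc m)"]) auto
    qed
  qed
  then obtain r where r: "\<And>k. fnorm E (\<lambda>t. u (r k) t - x t) \<le> (1/2)^k" "\<And>k. r k < r (Suc k)"
    by blast
  let ?v = "\<lambda>k t. \<bar>u (r k) t - x t\<bar>"
  have d: "(\<lambda>t. u (r k) t - x t) \<in> members E" for k
    using u x by (rule symmetric_space_diff)
  have v: "?v k \<in> members E \<and> fnorm E (?v k) \<le> (1/2)^k" for k
    using symmetric_space_solid[OF d[of k], of "?v k"] symmetric_space_measurable[OF d[of k]] r(1)[of k]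
    by (auto intro: order_trans)
  have "AE t in unit_leb. summable (\<lambda>k. ?v k t)"
    by (rule AE_summable_of_norm_geometric) (use v in auto)
  then have "AE t in unit_leb. (\<lambda>k. u (r k) t) \<longlonglongrightarrow> x t"
  proof eventually_elim
    case (elim t)
    then have "(\<lambda>k. \<bar>u (r k) t - x t\<bar>) \<longlonglongrightarrow> 0"
      by (rule summable_LIMSEQ_zero)
    then show ?case
      using LIM_zero_cancel tendsto_rabs_zero_iff by blast
  qed
  moreover have "strict_mono r"
    using r(2) by (simp add: strict_mono_Suc_iff)
  ultimately show thesis
    using that by blast
qed

end

subsection \<open>The space of integrable functions\<close>

lemma members_L1: "members L1 = {x. integrable unit_leb x}"
  and fnorm_L1: "fnorm L1 x = integral\<^sup>L unit_leb (\<lambda>t. \<bar>x t\<bar>)"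
  by (simp_all add: L1_def)

text \<open>A Cauchy sequence has an a.e. convergent subsequence, and Fatou's lemma upgrades its
  pointwise limit to a norm limit of the whole sequence.\<close>

lemma norm_complete_L1: "norm_complete L1"
  unfolding norm_complete_def
proof (intro allI impI, elim conjE)
  fix u :: "nat \<Rightarrow> real \<Rightarrow> real"
  assume "\<forall>n. u n \<in> members L1"
  then have int: "integrable unit_leb (u n)" for n
    by (simp add: members_L1)
  assume cauchy: "\<forall>e>0. \<exists>K. \<forall>m\<ge>K. \<forall>n\<ge>K. fnorm L1 (\<lambda>t. u m t - u n t) < e"
  then have "\<exists>N. \<forall>i\<ge>N. \<forall>j\<ge>N. (\<integral>t. norm (u i t - u j t) \<partial>unit_leb) < e" if "e > 0" for e
    using that by (simp add: fnorm_L1)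
  then obtain r where r: "strict_mono r" "AE t in unit_leb. Cauchy (\<lambda>i. u (r i) t)"
    using cauchy_L1_AE_cauchy_subseq[of unit_leb u, OF int] by blast
  \<comment> \<open>Where the subsequence diverges \<open>lim\<close> is unspecified, but this
    happens only on a null set.\<close>
  define x where "x t = lim (\<lambda>i. u (r i) t)" for t
  note [measurable] = borel_measurable_integrable[OF int]
  have [measurable]: "x \<in> borel_measurable unit_leb"
    unfolding x_def[abs_def] by (rule borel_measurable_lim_metric) measurable
  have conv: "AE t in unit_leb. (\<lambda>i. u (r i) t) \<longlonglongrightarrow> x t"
    using r(2) by eventually_elim (simp add: x_def Cauchy_convergent_iff convergent_LIMSEQ_iff)
  \<comment> \<open>Here \<open>n\<close> is fixed and \<open>i\<close> tends to infinity along the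
    subsequence. The Cauchy bound \<open>e\<close> survives in the limit as a non-strict one, so
    finiteness of the integral and the norm estimate come together.\<close>
  have fatou: "integrable unit_leb (\<lambda>t. u n t - x t) \<and> fnorm L1 (\<lambda>t. u n t - x t) \<le> e"
    if K: "\<forall>m\<ge>K. \<forall>n\<ge>K. fnorm L1 (\<lambda>t. u m t - u n t) < e" and "n \<ge> K" "e > 0" for K n e
  proof -
    have "(\<integral>\<^sup>+t. ennreal \<bar>u n t - x t\<bar> \<partial>unit_leb) =
        (\<integral>\<^sup>+t. liminf (\<lambda>i. ennreal \<bar>u n t - u (r i) t\<bar>) \<partial>unit_leb)"
    proof (rule nn_integral_cong_AE)
      show "AE t in unit_leb. ennreal \<bar>u n t - x t\<bar> = liminf (\<lambda>i. ennreal \<bar>u n t - u (r i) t\<bar>)"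
        using conv
      proof eventually_elim
        case (elim t)
        then have "(\<lambda>i. ennreal \<bar>u n t - u (r i) t\<bar>) \<longlonglongrightarrow> ennreal \<bar>u n t - x t\<bar>"
          by (intro tendsto_intros)
        then show ?case
          using lim_imp_Liminf[OF trivial_limit_sequentially] by fastforce
      qed
    qed
    also have "\<dots> \<le> liminf (\<lambda>i. \<integral>\<^sup>+t. ennreal \<bar>u n t - u (r i) t\<bar> \<partial>unit_leb)"
      by (rule nn_integral_liminf) measurable
    also have "\<dots> \<le> ennreal e"
    proof (rule Liminf_le)
      show "\<forall>\<^sub>F i in sequentially. (\<integral>\<^sup>+t. ennreal \<bar>u n t - u (r i) t\<bar> \<partial>unit_leb) \<le> ennreal e"
        unfolding eventually_sequentially
      proof (intro exI allI impI)
        fix i assume "K \<le> i"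
        then have "K \<le> r i"
          using seq_suble[OF r(1), of i] by linarith
        then have "fnorm L1 (\<lambda>t. u n t - u (r i) t) < e"
          using K \<open>n \<ge> K\<close> by blast
        moreover have "(\<integral>\<^sup>+t. ennreal \<bar>u n t - u (r i) t\<bar> \<partial>unit_leb) =
            ennreal (fnorm L1 (\<lambda>t. u n t - u (r i) t))"
          unfolding fnorm_L1 using int by (intro nn_integral_eq_integral) auto
        ultimately show "(\<integral>\<^sup>+t. ennreal \<bar>u n t - u (r i) t\<bar> \<partial>unit_leb) \<le> ennreal e"
          by (simp add: ennreal_leI)
      qed
    qed simp
    finally have le: "(\<integral>\<^sup>+t. ennreal \<bar>u n t - x t\<bar> \<partial>unit_leb) \<le> ennreal e" .
    then have i: "integrable unit_leb (\<lambda>t. u n t - x t)"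
      by (intro integrableI_bounded) (auto intro: le_less_trans)
    then have "ennreal (fnorm L1 (\<lambda>t. u n t - x t)) \<le> ennreal e"
      using le nn_integral_eq_integral[of unit_leb "\<lambda>t. \<bar>u n t - x t\<bar>"] by (simp add: fnorm_L1)
    with i \<open>e > 0\<close> show ?thesis
      by (simp add: ennreal_le_iff)
  qed
  show "\<exists>x\<in>members L1. norm_limit L1 u x"
  proof
    obtain K where "\<forall>m\<ge>K. \<forall>n\<ge>K. fnorm L1 (\<lambda>t. u m t - u n t) < 1"
      using cauchy zero_less_one by blast
    from fatou[OF this, of K] have "integrable unit_leb (\<lambda>t. u K t - x t)"
      by simp
    \<comment> \<open>\<open>x\<close> is recovered as \<open>u K - (u K - x)\<close>, a difference
      of integrable functions.\<close>
    with int[of K] have "integrable unit_leb (\<lambda>t. u K t - (u K t - x t))"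
      by (rule Bochner_Integration.integrable_diff)
    then show "x \<in> members L1"
      by (simp add: members_L1)
    show "norm_limit L1 u x"
      unfolding norm_limit_def LIMSEQ_iff
    proof (intro allI impI)
      fix e :: real assume "e > 0"
      then obtain K where "\<forall>m\<ge>K. \<forall>n\<ge>K. fnorm L1 (\<lambda>t. u m t - u n t) < e/2"
        using cauchy half_gt_zero by blast
      from fatou[OF this] \<open>e > 0\<close> have "fnorm L1 (\<lambda>t. u n t - x t) \<le> e/2" if "n \<ge> K" for n
        using that by simp
      moreover have "fnorm L1 (\<lambda>t. u n t - x t) \<ge> 0" for n
        by (simp add: fnorm_L1)
      ultimately show "\<exists>K. \<forall>n\<ge>K. norm (fnorm L1 (\<lambda>t. u n t - x t) - 0) < e"
        using \<open>e > 0\<close> by (intro exI[of _ K]) fastforce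
    qed
  qed
qed

text \<open>Open upper half-lines determine a finite Borel measure on the line. Finiteness also
  allows passing from the real-valued \<open>measure\<close> in \<open>equimeasurable\<close> to
  \<open>emeasure\<close>.\<close>

lemma equimeasurable_distr:
  assumes [measurable]: "x \<in> borel_measurable unit_leb" "y \<in> borel_measurable unit_leb"
    and eq: "equimeasurable x y"
  shows "distr unit_leb borel x = distr unit_leb borel y"
proof -
  interpret finite_measure unit_leb
    by (rule finite_measure_unit_leb)
  have *: "emeasure (distr unit_leb borel z) {\<tau><..} =
      ennreal (measure unit_leb {t \<in> space unit_leb. z t > \<tau>})"
    if [measurable]: "z \<in> borel_measurable unit_leb" for z :: "real \<Rightarrow> real" and \<tau>
  proof -
    have "z -` {\<tau><..} \<inter> space unit_leb = {t \<in> space unit_leb. z t > \<tau>}" by auto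
    then show ?thesis
      by (simp add: emeasure_distr emeasure_eq_measure)
  qed
  show ?thesis
    by (rule measure_eqI_lessThan) (use eq in \<open>auto simp: * equimeasurable_def\<close>)
qed

lemma symmetric_space_L1: "symmetric_space L1"
  unfolding symmetric_space_def
proof (intro conjI ballI impI)
  show "members L1 \<subseteq> borel_measurable unit_leb"
    by (auto simp: members_L1)
  show "seminormed_space L1"
    unfolding seminormed_space_def linear_space_def members_L1 fnorm_L1
  proof (intro conjI ballI allI)
    fix x y :: "real \<Rightarrow> real"
    assume "x \<in> {x. integrable unit_leb x}" "y \<in> {x. integrable unit_leb x}"
    then have i: "integrable unit_leb x" "integrable unit_leb y" by auto
    then have "(\<integral>t. \<bar>x t + y t\<bar> \<partial>unit_leb) \<le> (\<integral>t. \<bar>x t\<bar> + \<bar>y t\<bar> \<partial>unit_leb)"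
      by (intro integral_mono) auto
    with i show "(\<integral>t. \<bar>x t + y t\<bar> \<partial>unit_leb) \<le> (\<integral>t. \<bar>x t\<bar> \<partial>unit_leb) + (\<integral>t. \<bar>y t\<bar> \<partial>unit_leb)"
      by simp
  qed (auto simp: abs_mult)
  show "AE t in unit_leb. x t = 0" if "x \<in> members L1" "fnorm L1 x = 0" for x
    using that integral_nonneg_eq_0_iff_AE[of unit_leb "\<lambda>t. \<bar>x t\<bar>"]
    by (simp add: members_L1 fnorm_L1)
  show "norm_complete L1"
    by (rule norm_complete_L1)
  show "indicator {0..1} \<in> members L1"
    by (simp add: members_L1 integrable_indicator_iff emeasure_unit_leb)
  have "fnorm L1 (indicator {0..1}) = measure unit_leb (space unit_leb)"
    by (simp add: fnorm_L1)
  also have "\<dots> = 1"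
    by (simp add: measure_def emeasure_unit_leb)
  finally show "fnorm L1 (indicator {0..1}) = 1" .
next
  fix x y :: "real \<Rightarrow> real"
  assume x: "x \<in> members L1" and y: "y \<in> borel_measurable unit_leb"
    and le: "AE t in unit_leb. \<bar>y t\<bar> \<le> \<bar>x t\<bar>"
  have i: "integrable unit_leb y"
    by (rule Bochner_Integration.integrable_bound[of _ x]) (use x y le in \<open>auto simp: members_L1\<close>)
  then show "y \<in> members L1"
    by (simp add: members_L1)
  show "fnorm L1 y \<le> fnorm L1 x"
    unfolding fnorm_L1 using i x le by (intro integral_mono_AE) (auto simp: members_L1)
next
  fix x y :: "real \<Rightarrow> real"
  assume x: "x \<in> members L1" and y: "y \<in> borel_measurable unit_leb"
    and eq: "equimeasurable (\<lambda>t. \<bar>y t\<bar>) (\<lambda>t. \<bar>x t\<bar>)"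
  have abs: "(\<lambda>t. \<bar>x t\<bar>) \<in> borel_measurable unit_leb" "(\<lambda>t. \<bar>y t\<bar>) \<in> borel_measurable unit_leb"
    using x y by (auto simp: members_L1)
  \<comment> \<open>The integrals of \<open>\<bar>x t\<bar>\<close> and
    \<open>\<bar>y t\<bar>\<close> are both integrals of the identity against this common
    distribution.\<close>
  note d = equimeasurable_distr[OF abs(2,1) eq]
  have s: "(\<lambda>s::real. s) \<in> borel_measurable borel"
    by simp
  have "integrable (distr unit_leb borel (\<lambda>t. \<bar>x t\<bar>)) (\<lambda>s. s)"
    using x unfolding integrable_distr_eq[OF abs(1) s] by (simp add: members_L1)
  then have "integrable unit_leb (\<lambda>t. \<bar>y t\<bar>)"
    unfolding d[symmetric] integrable_distr_eq[OF abs(2) s] .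
  then show "y \<in> members L1"
    using y integrable_abs_iff unfolding members_L1 by blast
  show "fnorm L1 y = fnorm L1 x"
    using arg_cong[OF d, of "\<lambda>M. integral\<^sup>L M (\<lambda>s. s)"]
    unfolding fnorm_L1 integral_distr[OF abs(1) s] integral_distr[OF abs(2) s] .
qed

subsection \<open>Intersections of symmetric spaces\<close>

text \<open>Membership and bound are kept in one predicate, so the existence of some
  \<open>K\<close> expresses that the supremum of \<open>fnorm E x / c\<close> is finite.\<close>

definition dominated :: "(real fun_space \<times> real) set \<Rightarrow> (real \<Rightarrow> real) \<Rightarrow> real \<Rightarrow> bool" where
  "dominated I x K \<longleftrightarrow> (\<forall>(E, c)\<in>I. x \<in> members E \<and> fnorm E x \<le> c * K)"

text \<open>The supremum norm appears as the infimum of its upper bounds, so no \<open>Sup\<close>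
  of a possibly unbounded set occurs.\<close>

definition intersection_space :: "(real fun_space \<times> real) set \<Rightarrow> real fun_space" where
  "intersection_space I =
     \<lparr> members = {x. \<exists>K. dominated I x K}, fnorm = (\<lambda>x. Inf {K. dominated I x K}) \<rparr>"

text \<open>The pair \<open>(L1, 1)\<close> bounds the new norm below by the \<open>L1\<close> norm,
  which gives definiteness and half of the normalization. Constants at least 1 give the other half
  and permit division.\<close>

locale symmetric_family =
  fixes I :: "(real fun_space \<times> real) set"
  assumes symmetric: "\<And>E c. (E, c) \<in> I \<Longrightarrow> symmetric_space E"
    and const_ge_1: "\<And>E c. (E, c) \<in> I \<Longrightarrow> c \<ge> 1"
    and L1_in: "(L1, 1) \<in> I"
begin

section \<open>Dominating constants and the norm axioms\<close>

lemma dominatedD: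
  assumes "dominated I x K" "(E, c) \<in> I"
  shows "x \<in> members E" "fnorm E x \<le> c * K"
  using assms unfolding dominated_def by auto

lemma dominatedI:
  assumes "\<And>E c. (E, c) \<in> I \<Longrightarrow> x \<in> members E"
    and "\<And>E c. (E, c) \<in> I \<Longrightarrow> fnorm E x \<le> c * K"
  shows "dominated I x K"
  using assms unfolding dominated_def by auto

lemma dominated_fnorm_L1_le: "dominated I x K \<Longrightarrow> fnorm L1 x \<le> K"
  using dominatedD(2)[OF _ L1_in] by simp

lemma intersection_norm_le:
  assumes "dominated I x K"
  shows "x \<in> members (intersection_space I)" "fnorm (intersection_space I) x \<le> K"
proof -
  show "x \<in> members (intersection_space I)"
    using assms by (auto simp: intersection_space_def)
  have "bdd_below {K. dominated I x K}"
    using dominated_fnorm_L1_le by (intro bdd_belowI[of _ "fnorm L1 x"]) auto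
  then show "fnorm (intersection_space I) x \<le> K"
    using assms by (auto simp: intersection_space_def intro: cInf_lower)
qed

text \<open>The infimum is attained: after division by \<open>c > 0\<close>, each pair of the family
  gives a lower bound for all admissible \<open>K\<close>, hence for their infimum. Later estimates
  can therefore use the norm itself as dominating constant, without an epsilon.\<close>

lemma dominated_intersection_norm:
  assumes "x \<in> members (intersection_space I)"
  shows "dominated I x (fnorm (intersection_space I) x)"
proof (rule dominatedI)
  fix E c assume Ec: "(E, c) \<in> I"
  obtain K where K: "dominated I x K"
    using assms by (auto simp: intersection_space_def)
  then show "x \<in> members E"
    using Ec by (rule dominatedD)
  have c: "c > 0"
    using const_ge_1[OF Ec] by linarith
  have "fnorm E x / c \<le> Inf {K. dominated I x K}"
    using K dominatedD(2)[OF _ Ec] c by (intro cInf_greatest) (auto simp: field_simps)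
  then show "fnorm E x \<le> c * fnorm (intersection_space I) x"
    using c by (simp add: intersection_space_def field_simps)
qed

lemma fnorm_L1_le_intersection_norm:
  "x \<in> members (intersection_space I) \<Longrightarrow> fnorm L1 x \<le> fnorm (intersection_space I) x"
  using dominated_fnorm_L1_le dominated_intersection_norm by blast

lemma dominated_add:
  assumes "dominated I x K" "dominated I y L"
  shows "dominated I (\<lambda>t. x t + y t) (K + L)"
proof (rule dominatedI)
  fix E c assume Ec: "(E, c) \<in> I"
  note x = dominatedD[OF assms(1) Ec] and y = dominatedD[OF assms(2) Ec]
  note s = symmetric_space_add[OF symmetric[OF Ec] x(1) y(1)]
  show "(\<lambda>t. x t + y t) \<in> members E"
    by (rule s)
  show "fnorm E (\<lambda>t. x t + y t) \<le> c * (K + L)"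
    using s(2) x(2) y(2) by (simp add: distrib_left)
qed

lemma dominated_scale:
  assumes "dominated I x K"
  shows "dominated I (\<lambda>t. a * x t) (\<bar>a\<bar> * K)"
proof (rule dominatedI)
  fix E c assume Ec: "(E, c) \<in> I"
  note x = dominatedD[OF assms(1) Ec]
  note s = symmetric_space_scale[OF symmetric[OF Ec] x(1), of a]
  show "(\<lambda>t. a * x t) \<in> members E"
    by (rule s)
  show "fnorm E (\<lambda>t. a * x t) \<le> c * (\<bar>a\<bar> * K)"
    using s(2) mult_left_mono[OF x(2), of "\<bar>a\<bar>"] by (simp add: mult.left_commute)
qed

lemma seminormed_intersection_space: "seminormed_space (intersection_space I)"
  unfolding seminormed_space_def linear_space_def
proof (intro conjI ballI allI)
  let ?M = "intersection_space I"
  have "dominated I (\<lambda>t. 0) 0"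
    by (rule dominatedI)
      (simp_all add: symmetric_space_zero[OF symmetric] symmetric_space_norm_zero[OF symmetric])
  then show "(\<lambda>t. 0) \<in> members ?M"
    by (rule intersection_norm_le)
  fix x assume x: "x \<in> members ?M"
  have "0 \<le> fnorm L1 x"
    by (simp add: fnorm_L1)
  with fnorm_L1_le_intersection_norm[OF x] show "0 \<le> fnorm ?M x"
    by linarith
  show "(\<lambda>t. x t + y t) \<in> members ?M" "fnorm ?M (\<lambda>t. x t + y t) \<le> fnorm ?M x + fnorm ?M y"
    if "y \<in> members ?M" for y
    using that x by (auto intro: intersection_norm_le dominated_add dominated_intersection_norm)
  have scale: "(\<lambda>t. b * y t) \<in> members ?M \<and> fnorm ?M (\<lambda>t. b * y t) \<le> \<bar>b\<bar> * fnorm ?M y"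
    if "y \<in> members ?M" for y b
    using that by (auto intro: intersection_norm_le dominated_scale dominated_intersection_norm)
  fix a
  show "(\<lambda>t. a * x t) \<in> members ?M"
    using scale x by blast
  show "fnorm ?M (\<lambda>t. a * x t) = \<bar>a\<bar> * fnorm ?M x"
  proof (rule antisym)
    show "fnorm ?M (\<lambda>t. a * x t) \<le> \<bar>a\<bar> * fnorm ?M x"
      using scale x by blast
    show "\<bar>a\<bar> * fnorm ?M x \<le> fnorm ?M (\<lambda>t. a * x t)"
    proof (cases "a = 0")
      case True
      have "0 \<le> fnorm L1 (\<lambda>t. a * x t)"
        by (simp add: fnorm_L1)
      also have "\<dots> \<le> fnorm ?M (\<lambda>t. a * x t)"
        using scale x fnorm_L1_le_intersection_norm by blast
      finally show ?thesis
        using True by simp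
    next
      case False
      \<comment> \<open>Homogeneity needs only the inequality already proved: the reverse one is
        that inequality for the scalar \<open>inverse a\<close>.\<close>
      have "fnorm ?M (\<lambda>t. inverse a * (a * x t)) \<le> \<bar>inverse a\<bar> * fnorm ?M (\<lambda>t. a * x t)"
        using scale[of "\<lambda>t. a * x t" "inverse a"] scale[OF x] by blast
      moreover have "(\<lambda>t. inverse a * (a * x t)) = x"
        using False by auto
      ultimately show ?thesis
        using False by (simp add: field_simps abs_inverse)
    qed
  qed
qed

lemma norm_complete_intersection_space: "norm_complete (intersection_space I)"
  unfolding norm_complete_def
proof (intro allI impI, elim conjE)
  let ?M = "intersection_space I"
  fix u :: "nat \<Rightarrow> real \<Rightarrow> real"
  assume u: "\<forall>n. u n \<in> members ?M"
  assume cauchy: "\<forall>e>0. \<exists>K. \<forall>m\<ge>K. \<forall>n\<ge>K. fnorm ?M (\<lambda>t. u m t - u n t) < e"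
  have uE: "u n \<in> members E" if "(E, c) \<in> I" for E c n
    using u that dominatedD(1) dominated_intersection_norm by blast
  \<comment> \<open>The difference is written as a sum with a multiple by -1 to fit
    \<open>dominated_add\<close> and \<open>dominated_scale\<close>.\<close>
  have "dominated I (\<lambda>t. u m t + (-1) * u n t) (fnorm ?M (u m) + \<bar>-1\<bar> * fnorm ?M (u n))" for m n
    using u by (intro dominated_add dominated_scale dominated_intersection_norm) auto
  then have "(\<lambda>t. u m t + (-1) * u n t) \<in> members ?M" for m n
    by (rule intersection_norm_le)
  then have diff: "dominated I (\<lambda>t. u m t - u n t) (fnorm ?M (\<lambda>t. u m t - u n t))" for m n
    by (intro dominated_intersection_norm) simp
  have limE: "\<exists>y\<in>members E. norm_limit E u y" if Ec: "(E, c) \<in> I" for E c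
  proof -
    have c: "c > 0"
      using const_ge_1[OF Ec] by linarith
    have "\<exists>K. \<forall>m\<ge>K. \<forall>n\<ge>K. fnorm E (\<lambda>t. u m t - u n t) < e" if "e > 0" for e
    proof -
      obtain K where K: "\<forall>m\<ge>K. \<forall>n\<ge>K. fnorm ?M (\<lambda>t. u m t - u n t) < e / c"
        using cauchy \<open>e > 0\<close> c by (meson divide_pos_pos)
      have "fnorm E (\<lambda>t. u m t - u n t) < e" if "m \<ge> K" "n \<ge> K" for m n
      proof -
        have "c * fnorm ?M (\<lambda>t. u m t - u n t) < e"
          using K that c by (simp add: pos_less_divide_eq mult.commute)
        with dominatedD(2)[OF diff Ec, of m n] show ?thesis
          by linarith
      qed
      then show ?thesis by blast
    qed
    then show ?thesis
      using symmetric_space_complete[OF symmetric[OF Ec], of u, OF uE[OF Ec]] by blast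
  qed
  \<comment> \<open>The candidate limit is taken in \<open>L1\<close>, so that it is chosen before
    any particular \<open>E\<close>.\<close>
  obtain x where x: "x \<in> members L1" "norm_limit L1 u x"
    using limE[OF L1_in] by blast
  obtain r where r: "strict_mono r" "AE t in unit_leb. (\<lambda>k. u (r k) t) \<longlonglongrightarrow> x t"
    using norm_limit_AE_subseq[OF symmetric_space_L1 uE[OF L1_in] x] by blast
  \<comment> \<open>The limit \<open>y\<close> in \<open>E\<close> is compared with \<open>x\<close>
    along a subsequence of \<open>r\<close>: it converges a.e. to both, so they agree a.e.\<close>
  have limx: "x \<in> members E \<and> norm_limit E u x" if Ec: "(E, c) \<in> I" for E c
  proof -
    note E = symmetric[OF Ec]
    obtain y where y: "y \<in> members E" "norm_limit E u y"
      using limE[OF Ec] by blast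
    obtain s where s: "strict_mono s" "AE t in unit_leb. (\<lambda>k. u (r (s k)) t) \<longlonglongrightarrow> y t"
      using norm_limit_AE_subseq[OF E uE[OF Ec] y(1) norm_limit_subseq[OF y(2) r(1)]] by blast
    have ae: "AE t in unit_leb. x t = y t"
      using r(2) s(2)
    proof eventually_elim
      case (elim t)
      from LIMSEQ_subseq_LIMSEQ[OF elim(1) s(1)] elim(2) show ?case
        by (simp add: o_def LIMSEQ_unique)
    qed
    have meas: "x \<in> borel_measurable unit_leb"
      by (rule symmetric_space_measurable[OF symmetric_space_L1 x(1)])
    have xE: "x \<in> members E"
      by (rule symmetric_space_solid(1)[OF E y(1) meas]) (use ae in auto)
    \<comment> \<open>Replacing \<open>y\<close> by the a.e. equal \<open>x\<close> inside the
      seminorm is justified by solidity.\<close>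
    have "fnorm E (\<lambda>t. u n t - x t) \<le> fnorm E (\<lambda>t. u n t - y t)" for n
    proof (rule symmetric_space_solid(2)[OF E])
      show "(\<lambda>t. u n t - y t) \<in> members E"
        by (rule symmetric_space_diff[OF E uE[OF Ec] y(1)])
      show "(\<lambda>t. u n t - x t) \<in> borel_measurable unit_leb"
        by (intro symmetric_space_measurable[OF E] symmetric_space_diff[OF E] uE[OF Ec] xE)
      show "AE t in unit_leb. \<bar>u n t - x t\<bar> \<le> \<bar>u n t - y t\<bar>"
        using ae by eventually_elim simp
    qed
    moreover have "0 \<le> fnorm E (\<lambda>t. u n t - x t)" for n
      by (intro symmetric_space_norm_nonneg[OF E] symmetric_space_diff[OF E] uE[OF Ec] xE)
    ultimately have "norm_limit E u x"
      using y(2) unfolding norm_limit_def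
      by (intro tendsto_sandwich[OF _ _ tendsto_const y(2)[unfolded norm_limit_def]]) auto
    with xE show ?thesis by blast
  qed
  \<comment> \<open>Convergence in each \<open>E\<close> separately may have no uniform rate.
    Letting \<open>m\<close> tend to infinity in the triangle inequality removes the rate and leaves
    \<open>c * e\<close>, with the same \<open>e\<close> for the whole family.\<close>
  have close: "dominated I (\<lambda>t. u n t - x t) e"
    if K: "\<forall>m\<ge>K. \<forall>n\<ge>K. fnorm ?M (\<lambda>t. u m t - u n t) < e" and "n \<ge> K" for K n e
  proof (rule dominatedI)
    fix E c assume Ec: "(E, c) \<in> I"
    note E = symmetric[OF Ec]
    have xE: "x \<in> members E" and lim: "norm_limit E u x"
      using limx[OF Ec] by auto
    have dE: "(\<lambda>t. u m t - x t) \<in> members E" for m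
      by (rule symmetric_space_diff[OF E uE[OF Ec] xE])
    show "(\<lambda>t. u n t - x t) \<in> members E"
      by (rule dE)
    have "fnorm E (\<lambda>t. u n t - x t) \<le> c * e + fnorm E (\<lambda>t. u m t - x t)" if "m \<ge> K" for m
    proof -
      have "fnorm E (\<lambda>t. u n t - u m t) \<le> c * fnorm ?M (\<lambda>t. u n t - u m t)"
        by (rule dominatedD(2)[OF diff Ec])
      also have "\<dots> \<le> c * e"
        using K \<open>n \<ge> K\<close> that const_ge_1[OF Ec] by (intro mult_left_mono) (auto intro: less_imp_le)
      finally show ?thesis
        using symmetric_space_add(2)[OF E symmetric_space_diff[OF E uE[OF Ec] uE[OF Ec]] dE[of m], of n m]
        by simp
    qed
    moreover have "(\<lambda>m. c * e + fnorm E (\<lambda>t. u m t - x t)) \<longlonglongrightarrow> c * e + 0"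
      using lim unfolding norm_limit_def by (intro tendsto_intros)
    ultimately show "fnorm E (\<lambda>t. u n t - x t) \<le> c * e"
      using LIMSEQ_le_const by fastforce
  qed
  show "\<exists>x\<in>members ?M. norm_limit ?M u x"
  proof
    obtain K where "\<forall>m\<ge>K. \<forall>n\<ge>K. fnorm ?M (\<lambda>t. u m t - u n t) < 1"
      using cauchy zero_less_one by blast
    then have "dominated I (\<lambda>t. u K t - x t) 1"
      by (rule close) simp
    then have "dominated I (\<lambda>t. u K t + (-1) * (u K t - x t)) (fnorm ?M (u K) + \<bar>-1\<bar> * 1)"
      using u by (intro dominated_add dominated_scale dominated_intersection_norm) auto
    then show "x \<in> members ?M"
      using intersection_norm_le(1) by fastforce
    show "norm_limit ?M u x"
      unfolding norm_limit_def LIMSEQ_iff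
    proof (intro allI impI)
      fix e :: real assume "e > 0"
      then obtain K where K: "\<forall>m\<ge>K. \<forall>n\<ge>K. fnorm ?M (\<lambda>t. u m t - u n t) < e/2"
        using cauchy half_gt_zero by blast
      have "norm (fnorm ?M (\<lambda>t. u n t - x t) - 0) < e" if "n \<ge> K" for n
      proof -
        note d = intersection_norm_le[OF close[OF K that]]
        have "0 \<le> fnorm ?M (\<lambda>t. u n t - x t)"
          using seminormed_intersection_space d(1) unfolding seminormed_space_def by blast
        with d(2) \<open>e > 0\<close> show ?thesis by simp
      qed
      then show "\<exists>K. \<forall>n\<ge>K. norm (fnorm ?M (\<lambda>t. u n t - x t) - 0) < e"
        by blast
    qed
  qed
qed

lemma symmetric_space_intersection_space: "symmetric_space (intersection_space I)"
  unfolding symmetric_space_def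
proof (intro conjI ballI impI)
  let ?M = "intersection_space I"
  have L1: "x \<in> members L1" if "x \<in> members ?M" for x
    using dominatedD(1)[OF dominated_intersection_norm[OF that] L1_in] .
  show "members ?M \<subseteq> borel_measurable unit_leb"
    using L1 symmetric_space_measurable[OF symmetric_space_L1] by blast
  show "seminormed_space ?M"
    by (rule seminormed_intersection_space)
  show "norm_complete ?M"
    by (rule norm_complete_intersection_space)
  show "AE t in unit_leb. x t = 0" if x: "x \<in> members ?M" "fnorm ?M x = 0" for x
  proof (rule symmetric_space_norm_eq_0[OF symmetric_space_L1 L1[OF x(1)]])
    show "fnorm L1 x = 0"
      using fnorm_L1_le_intersection_norm[OF x(1)] x(2)
        symmetric_space_norm_nonneg[OF symmetric_space_L1 L1[OF x(1)]] by linarith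
  qed
  \<comment> \<open>The constant 1 works because every \<open>c\<close> is at least 1; the
    \<open>L1\<close> norm supplies the opposite inequality.\<close>
  have "dominated I (indicator {0..1}) 1"
    by (rule dominatedI) (simp_all add: symmetric_space_indicator[OF symmetric] const_ge_1)
  note ind = intersection_norm_le[OF this]
  show "indicator {0..1} \<in> members ?M"
    by (rule ind)
  show "fnorm ?M (indicator {0..1}) = 1"
    using ind(2) fnorm_L1_le_intersection_norm[OF ind(1)]
      symmetric_space_indicator(2)[OF symmetric_space_L1] by linarith
next
  let ?M = "intersection_space I"
  fix x y assume x: "x \<in> members ?M" and y: "y \<in> borel_measurable unit_leb"
    and le: "AE t in unit_leb. \<bar>y t\<bar> \<le> \<bar>x t\<bar>"
  have "dominated I y (fnorm ?M x)"
  proof (rule dominatedI)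
    fix E c assume Ec: "(E, c) \<in> I"
    note d = dominatedD[OF dominated_intersection_norm[OF x] Ec]
    note s = symmetric_space_solid[OF symmetric[OF Ec] d(1) y le]
    show "y \<in> members E"
      by (rule s)
    show "fnorm E y \<le> c * fnorm ?M x"
      using s(2) d(2) by linarith
  qed
  note this = intersection_norm_le[OF this]
  then show "y \<in> members ?M" "fnorm ?M y \<le> fnorm ?M x"
    by auto
next
  let ?M = "intersection_space I"
  have dom: "y \<in> members E \<and> fnorm E y = fnorm E x"
    if "(E, c) \<in> I" "x \<in> members ?M" "y \<in> borel_measurable unit_leb"
      "equimeasurable (\<lambda>t. \<bar>y t\<bar>) (\<lambda>t. \<bar>x t\<bar>)" for E c x y
    using symmetric_space_rearrange[OF symmetric[OF that(1)] _ that(3,4)]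
      dominatedD(1)[OF dominated_intersection_norm[OF that(2)] that(1)] by blast
  fix x y assume x: "x \<in> members ?M" and y: "y \<in> borel_measurable unit_leb"
    and eq: "equimeasurable (\<lambda>t. \<bar>y t\<bar>) (\<lambda>t. \<bar>x t\<bar>)"
  note d = dom[OF _ x y eq]
  \<comment> \<open>Norms of \<open>x\<close> and \<open>y\<close> agree in every space of the
    family, so exactly the same constants are admissible; membership and equality of the infima
    follow together.\<close>
  have "dominated I y = dominated I x"
    using d dominatedD(1)[OF dominated_intersection_norm[OF x]]
    by (intro ext) (fastforce simp: dominated_def)
  with x show "y \<in> members ?M" "fnorm ?M y = fnorm ?M x"
    by (simp_all add: intersection_space_def)
qed

end

section \<open>The family attached to \<open>B\<close>\<close>

theorem theorem1:
  fixes B :: "(real \<Rightarrow> real) set"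
  assumes "closed_subspace B L1"
    and "reflexive_space (L1\<lparr>members := B\<rparr>)"
  shows "\<exists>mB. symmetric_space mB \<and>
           transferable B mB \<and>
           (\<forall>x\<in>B. fnorm L1 x = fnorm mB x) \<and>
           (\<forall>E\<in>transfer_class B. boundedly_included mB E)"
proof -
  \<comment> \<open>Pairing each space with a constant normalizes it: after division by
    \<open>c\<close>, the norms of any \<open>x\<close> in \<open>B\<close> are all at most its
    \<open>L1\<close> norm, so their supremum is finite on \<open>B\<close>.\<close>
  define I where "I = {(E, c). symmetric_space E \<and> c \<ge> 1 \<and> B \<subseteq> members E \<and>
    (\<forall>x\<in>B. fnorm E x \<le> c * fnorm L1 x)}"
  let ?M = "intersection_space I"
  have B: "B \<subseteq> members L1"
    using assms(1) by (simp add: closed_subspace_def)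
  interpret symmetric_family I
    by unfold_locales (use B symmetric_space_L1 in \<open>auto simp: I_def\<close>)
  have dom: "dominated I x (fnorm L1 x)" if "x \<in> B" for x
    using that by (auto simp: I_def dominated_def)
  have mem: "B \<subseteq> members ?M"
    using intersection_norm_le(1)[OF dom] by blast
  have eq: "fnorm L1 x = fnorm ?M x" if "x \<in> B" for x
    using that mem intersection_norm_le(2)[OF dom[OF that]] fnorm_L1_le_intersection_norm[of x]
    by (intro antisym) blast+
  have "symmetric_space ?M"
    by (rule symmetric_space_intersection_space)
  moreover have "transferable B ?M"
    unfolding transferable_def using mem eq by (auto intro!: exI[of _ 1])
  moreover have "boundedly_included ?M E" if E: "E \<in> transfer_class B" for E
  proof -
    \<comment> \<open>A transfer constant of \<open>E\<close> puts \<open>(E, c)\<close> into the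
      family, and the same \<open>c\<close> is then the norm bound of the inclusion.\<close>
    obtain c where "c \<ge> 1" "\<forall>x\<in>B. fnorm E x \<le> c * fnorm L1 x"
      using E unfolding transfer_class_def transferable_def by blast
    with E have Ec: "(E, c) \<in> I"
      by (simp add: I_def transfer_class_def transferable_def)
    then show ?thesis
      using dominatedD[OF dominated_intersection_norm Ec]
      unfolding boundedly_included_def by blast
  qed
  ultimately show ?thesis
    using eq by blast
qed

end
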